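(* Let $X$ be a topological space and let $\mathscr{H}$ be an ideal in $X$. Suppose that $X=X_1\cup\cdots\cup X_n$, where $X_i$ is a subspace of $X$ which is connected modulo $\mathscr{H}|_{X_i}$ for each $i=1,\dots,n$. Suppose that $A=X_1\cap\cdots\cap X_n$ is connected modulo $\mathscr{H}|_A$ and is not in $\mathscr{H}$. Then $X$ is connected modulo $\mathscr{H}$.
   Context: An ideal in a set $X$ is a non-empty collection of subsets of $X$ closed under taking subsets and under binary unions (it need not be proper). For an ideal $\mathscr{H}$ in a space $X$, a mapping $f:X\to[0,1]$ is $2$-valued modulo $\mathscr{H}$ if $f^{-1}(0)\notin\mathscr{H}$, $f^{-1}(1)\notin\mathscr{H}$ and $X\setminus(f^{-1}(0)\cup f^{-1}(1))\in\mathscr{H}$. The space $X$ is connected modulo $\mathscr{H}$ if there is no continuous $f:X\to[0,1]$ which is $2$-valued modulo $\mathscr{H}$. For a subset $A$ of $X$, $\mathscr{H}|_A=\{H\cap A:H\in\mathscr{H}\}$, which is an ideal in $A$. Here $n$ is a positive integer. *)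

theory Defs
  imports "HOL-Analysis.Analysis"
begin

definition set_ideal :: "'a set \<Rightarrow> 'a set set \<Rightarrow> bool" where
  "set_ideal X \<H> \<longleftrightarrow>
     \<H> \<subseteq> Pow X \<and> \<H> \<noteq> {} \<and>
     (\<forall>A\<in>\<H>. \<forall>B. B \<subseteq> A \<longrightarrow> B \<in> \<H>) \<and>
     (\<forall>A\<in>\<H>. \<forall>B\<in>\<H>. A \<union> B \<in> \<H>)"

definition ideal_trace :: "'a set set \<Rightarrow> 'a set \<Rightarrow> 'a set set" where
  "ideal_trace \<H> A = {H \<inter> A |H. H \<in> \<H>}"

definition two_valued_modulo :: "'a set \<Rightarrow> 'a set set \<Rightarrow> ('a \<Rightarrow> real) \<Rightarrow> bool" where
  "two_valued_modulo X \<H> f \<longleftrightarrow>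
     X \<inter> f -` {0} \<notin> \<H> \<and>
     X \<inter> f -` {1} \<notin> \<H> \<and>
     X - (f -` {0} \<union> f -` {1}) \<in> \<H>"

definition connected_modulo :: "'a topology \<Rightarrow> 'a set set \<Rightarrow> bool" where
  "connected_modulo X \<H> \<longleftrightarrow>
     \<not> (\<exists>f. continuous_map X (top_of_set {0..1::real}) f \<and>
             two_valued_modulo (topspace X) \<H> f)"

end

theory Submission
  imports Defs
begin

text \<open>
  Modulo the ideal, a function that is 2-valued on \<open>X\<close> is constant on every subspace that is
  connected modulo the trace. On \<open>A\<close> some value \<open>v\<close> is taken on a set outside the ideal,
  because \<open>A\<close> itself is outside it. Each \<open>S i\<close> contains \<open>A\<close>, so \<open>v\<close> is the value
  taken modulo the ideal on \<open>S i\<close>. Hence the other fibre is a finite union of members of the ideal.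
\<close>

text \<open>Since \<open>\<H>\<close> is closed under subsets, cutting a member down to
  \<open>Y\<close> stays inside \<open>\<H>\<close>. Traces can thus be dropped and all later
  arguments carried out in \<open>\<H>\<close> itself.\<close>

lemma ideal_trace_iff:
  assumes "set_ideal X \<H>" "B \<subseteq> Y"
  shows "B \<in> ideal_trace \<H> Y \<longleftrightarrow> B \<in> \<H>"
proof
  assume "B \<in> ideal_trace \<H> Y"
  then obtain H where "H \<in> \<H>" "B = H \<inter> Y"
    by (auto simp: ideal_trace_def)
  then show "B \<in> \<H>"
    using assms(1) unfolding set_ideal_def by (simp add: Int_lower1)
next
  assume "B \<in> \<H>"
  then show "B \<in> ideal_trace \<H> Y"
    using assms(2) unfolding ideal_trace_def by blast
qed

lemma set_ideal_mono: "set_ideal X \<H> \<Longrightarrow> B \<in> \<H> \<Longrightarrow> C \<subseteq> B \<Longrightarrow> C \<in> \<H>"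
  unfolding set_ideal_def by blast

lemma set_ideal_Un: "set_ideal X \<H> \<Longrightarrow> B \<in> \<H> \<Longrightarrow> C \<in> \<H> \<Longrightarrow> B \<union> C \<in> \<H>"
  unfolding set_ideal_def by blast

lemma set_ideal_empty: "set_ideal X \<H> \<Longrightarrow> {} \<in> \<H>"
  unfolding set_ideal_def by blast

lemma set_ideal_UN:
  assumes "set_ideal X \<H>" "finite I" "\<And>i. i \<in> I \<Longrightarrow> F i \<in> \<H>"
  shows "(\<Union>i\<in>I. F i) \<in> \<H>"
  using assms(2,3)
  by (induction rule: finite_induct)
    (auto intro: set_ideal_empty[OF assms(1)] set_ideal_Un[OF assms(1)])

text \<open>Restriction to \<open>Y\<close> keeps \<open>f\<close> continuous and only shrinks the
  exceptional set, so \<open>f\<close> can fail to be 2-valued on \<open>Y\<close> only because one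
  of its fibres there is small.\<close>

lemma connected_modulo_subtopology_fibre:
  assumes ideal: "set_ideal (topspace X) \<H>"
    and Y: "Y \<subseteq> topspace X"
    and conn: "connected_modulo (subtopology X Y) (ideal_trace \<H> Y)"
    and cont: "continuous_map X (top_of_set {0..1::real}) f"
    and rest: "topspace X - (f -` {0} \<union> f -` {1}) \<in> \<H>"
  shows "Y \<inter> f -` {0} \<in> \<H> \<or> Y \<inter> f -` {1} \<in> \<H>"
proof -
  have "\<not> two_valued_modulo Y (ideal_trace \<H> Y) f"
    using conn continuous_map_from_subtopology[OF cont, of Y]
    unfolding connected_modulo_def topspace_subtopology_subset[OF Y] by blast
  moreover have "Y - (f -` {0} \<union> f -` {1}) \<in> \<H>"
    by (rule set_ideal_mono[OF ideal rest]) (use Y in blast)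
  ultimately show ?thesis
    unfolding two_valued_modulo_def
    by (simp add: ideal_trace_iff[OF ideal])
qed

theorem theorem2p11:
  fixes X :: "'a topology" and \<H> :: "'a set set"
    and n :: nat and S :: "nat \<Rightarrow> 'a set" and A :: "'a set"
  assumes "set_ideal (topspace X) \<H>"
    and "n \<ge> 1"
    and "topspace X = (\<Union>i\<in>{1..n}. S i)"
    and "\<And>i. i \<in> {1..n} \<Longrightarrow> connected_modulo (subtopology X (S i)) (ideal_trace \<H> (S i))"
    and "A = (\<Inter>i\<in>{1..n}. S i)"
    and "connected_modulo (subtopology X A) (ideal_trace \<H> A)"
    and "A \<notin> \<H>"
  shows "connected_modulo X \<H>"
  unfolding connected_modulo_def
proof clarify
  fix f
  assume cont: "continuous_map X (top_of_set {0..1::real}) f"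
    and "two_valued_modulo (topspace X) \<H> f"
  then have zero: "topspace X \<inter> f -` {0} \<notin> \<H>" and one: "topspace X \<inter> f -` {1} \<notin> \<H>"
    and rest: "topspace X - (f -` {0} \<union> f -` {1}) \<in> \<H>"
    unfolding two_valued_modulo_def by auto
  note ideal = assms(1)
  have A_subset: "A \<subseteq> S i" and S_subset: "S i \<subseteq> topspace X" if "i \<in> {1..n}" for i
    using that assms(3,5) by auto
  \<comment> \<open>The index 1 is available because \<open>n \<ge> 1\<close>; over an empty index
    set the intersection would be \<open>UNIV\<close>.\<close>
  have A: "A \<subseteq> topspace X"
    using A_subset[of 1] S_subset[of 1] assms(2) by auto
  have S_fibre: "S i \<inter> f -` {0} \<in> \<H> \<or> S i \<inter> f -` {1} \<in> \<H>" if "i \<in> {1..n}" for i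
    by (rule connected_modulo_subtopology_fibre[OF ideal S_subset[OF that] assms(4)[OF that] cont rest])
  have A_some_fibre: "A \<inter> f -` {0} \<notin> \<H> \<or> A \<inter> f -` {1} \<notin> \<H>"
  proof (rule ccontr)
    assume "\<not> ?thesis"
    \<comment> \<open>Values strictly between 0 and 1 may occur on \<open>A\<close>, so the
      exceptional set is needed to complete the cover of \<open>A\<close>.\<close>
    then have "(A \<inter> f -` {0}) \<union> (A \<inter> f -` {1}) \<union> (topspace X - (f -` {0} \<union> f -` {1})) \<in> \<H>"
      using rest by (intro set_ideal_Un[OF ideal]) auto
    then have "A \<in> \<H>"
      by (rule set_ideal_mono[OF ideal]) (use A in blast)
    with assms(7) show False ..
  qed
  \<comment> \<open>Stated for arbitrary values \<open>u\<close> and \<open>v\<close>, so that one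
    argument serves both assignments of 0 and 1.\<close>
  have fibre: "topspace X \<inter> f -` {u} \<in> \<H>"
    if v: "A \<inter> f -` {v} \<notin> \<H>"
      and uv: "\<And>i. i \<in> {1..n} \<Longrightarrow> S i \<inter> f -` {u} \<in> \<H> \<or> S i \<inter> f -` {v} \<in> \<H>" for u v
  proof -
    have "S i \<inter> f -` {u} \<in> \<H>" if i: "i \<in> {1..n}" for i
    proof -
      have "S i \<inter> f -` {v} \<notin> \<H>"
        using v set_ideal_mono[OF ideal, of "S i \<inter> f -` {v}" "A \<inter> f -` {v}"] A_subset[OF i] by blast
      with uv[OF i] show ?thesis by blast
    qed
    then have "(\<Union>i\<in>{1..n}. S i \<inter> f -` {u}) \<in> \<H>"
      by (intro set_ideal_UN[OF ideal]) auto
    then show ?thesis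
      using assms(3) by (simp add: Int_UN_distrib2)
  qed
  from A_some_fibre show False
  proof
    assume "A \<inter> f -` {0} \<notin> \<H>"
    \<comment> \<open>Here \<open>v\<close> is 0 and \<open>u\<close> is 1: the fibre over 1 becomes
      small, against \<open>one\<close>. The other case swaps the two values.\<close>
    then show False using fibre[of 0 1] S_fibre one by blast
  next
    assume "A \<inter> f -` {1} \<notin> \<H>"
    then show False using fibre[of 1 0] S_fibre zero by blast
  qed
qed

end
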